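(* Let $R$ be a complete topological Hausdorff ring that has a sequence of units converging to $0$ and a countable fundamental system of open neighbourhoods of $0$. Let $M$ and $N$ be topological $R$-modules such that $M$ is Hausdorff, complete, finitely generated and has a countable fundamental system of open neighbourhoods of $0$. Then each $R$-linear map $f: M\rightarrow N$ is continuous.
   Context: Rings have a $1$ and are not necessarily commutative; an $R$-module is a left $R$-module. A Cauchy sequence in a topological group $G$ with neutral element $e$ is a sequence $(x_n)_{n\in\mathbb{N}}$ such that for every neighbourhood $V$ of $e$ there is an $N_0\in\mathbb{N}$ with $x_m\cdot x_k^{-1}\in V$ for all $m,k\geq N_0$. A topological group having a countable fundamental system of open neighbourhoods of its neutral element is called complete if every Cauchy sequence in it converges in it. A topological Hausdorff module (resp. topological Hausdorff ring) with a countable fundamental system of open neighbourhoods of $0$ is called complete if its additive group is complete. *)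

theory Defs
  imports "HOL-Analysis.Analysis"
begin

text \<open>
  Rings are unital and not necessarily commutative. The class \<^class>\<open>ring_1\<close> is avoided because it
  excludes the zero ring; the identity element comes from \<^class>\<open>topological_monoid_mult\<close> instead.
  No separation axiom is built in.
\<close>

class topological_ring = topological_ab_group_add + topological_monoid_mult + ring

definition unit_elt :: "'a::monoid_mult \<Rightarrow> bool"
  where "unit_elt u \<longleftrightarrow> (\<exists>v. u * v = 1 \<and> v * u = 1)"

definition group_Cauchy :: "(nat \<Rightarrow> 'a::topological_group_add) \<Rightarrow> bool"
  where "group_Cauchy x \<longleftrightarrow>
    (\<forall>V. 0 \<in> interior V \<longrightarrow> (\<exists>N0. \<forall>m\<ge>N0. \<forall>k\<ge>N0. x m - x k \<in> V))"

definition countable_nhds_basis_0 :: "'a::topological_group_add itself \<Rightarrow> bool"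
  where "countable_nhds_basis_0 _ \<longleftrightarrow>
    (\<exists>B :: 'a set set. countable B \<and> (\<forall>U\<in>B. open U \<and> 0 \<in> U) \<and>
      (\<forall>V. 0 \<in> interior V \<longrightarrow> (\<exists>U\<in>B. U \<subseteq> V)))"

text \<open>Sequential completeness; only meaningful together with \<^const>\<open>countable_nhds_basis_0\<close>,
  which is always assumed alongside it.\<close>

definition group_complete :: "'a::topological_group_add itself \<Rightarrow> bool"
  where "group_complete _ \<longleftrightarrow>
    (\<forall>x :: nat \<Rightarrow> 'a. group_Cauchy x \<longrightarrow> (\<exists>l. x \<longlonglongrightarrow> l))"

text \<open>The library locale \<^locale>\<open>module\<close> requires a commutative nonzero ring of scalars.\<close>

locale left_module =
  fixes smul :: "'r::{ring,monoid_mult} \<Rightarrow> 'm::ab_group_add \<Rightarrow> 'm"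
  assumes smul_right_distrib: "smul a (x + y) = smul a x + smul a y"
    and smul_left_distrib: "smul (a + b) x = smul a x + smul b x"
    and smul_smul: "smul a (smul b x) = smul (a * b) x"
    and smul_one: "smul 1 x = x"

locale topological_left_module = left_module smul
  for smul :: "'r::topological_ring \<Rightarrow> 'm::topological_ab_group_add \<Rightarrow> 'm" +
  assumes continuous_smul: "continuous_on UNIV (\<lambda>(a, x). smul a x)"

definition finitely_generated ::
    "('r::{ring,monoid_mult} \<Rightarrow> 'm::ab_group_add \<Rightarrow> 'm) \<Rightarrow> bool"
  where "finitely_generated smul \<longleftrightarrow>
    (\<exists>S. finite S \<and> (\<forall>x. \<exists>c. x = (\<Sum>s\<in>S. smul (c s) s)))"

locale left_module_hom = M: left_module smulM + N: left_module smulN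
  for smulM :: "'r::{ring,monoid_mult} \<Rightarrow> 'm::ab_group_add \<Rightarrow> 'm"
    and smulN :: "'r \<Rightarrow> 'n::ab_group_add \<Rightarrow> 'n" +
  fixes f :: "'m \<Rightarrow> 'n"
  assumes map_add: "f (x + y) = f x + f y"
    and map_smul: "f (smulM a x) = smulN a (f x)"

end

theory Submission
  imports Defs
begin

text \<open>
  The statement is an open mapping theorem in disguise. Let \<open>S\<close> be a finite generating set of \<open>M\<close>
  and, for a neighbourhood \<open>V\<close> of \<open>0\<close> in \<open>R\<close>, let \<open>P(V)\<close> be the set of the combinations
  \<open>\<Sum>s\<in>S. c s \<cdot> s\<close> whose coefficients all lie in \<open>V\<close>. The map \<open>f\<close> sends such a combination to
  \<open>\<Sum>s\<in>S. c s \<cdot> f s\<close>, which is small in \<open>N\<close> once \<open>V\<close> is small, because the scalar action on \<open>N\<close> is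
  continuous. So \<open>f\<close> is continuous at \<open>0\<close>, hence everywhere, as soon as every \<open>P(V)\<close> is a
  neighbourhood of \<open>0\<close> in \<open>M\<close>, that is, as soon as the surjection \<open>R\<^sup>S \<rightarrow> M\<close> is open.

  This is Banach's argument, with the units \<open>u n\<close> tending to \<open>0\<close> taking the place of the scalars
  \<open>1/n\<close>. For fixed \<open>x = \<Sum>s\<in>S. c s \<cdot> s\<close> the coefficients \<open>u n * c s\<close> tend to \<open>0\<close>, so
  \<open>u n \<cdot> x \<in> P(V)\<close> for some \<open>n\<close>, and \<open>M\<close> is the union of the sets
  \<open>{x. u n \<cdot> x \<in> closure P(V)}\<close>. The Baire theorem (\<open>baire_complete_group\<close>) gives one of them
  interior points; since \<open>u n\<close> is a unit, multiplication by it is a homeomorphism, and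
  \<open>closure P(V)\<close> itself has interior points. Differences of these fill a neighbourhood
  of \<open>0\<close> (\<open>closure_combinations_nhd\<close>). Completeness of \<open>R\<close> then removes the closure by successive
  approximation: a point of \<open>closure P(V)\<close> is the sum of a series of combinations whose
  coefficients shrink so fast that their partial sums converge in \<open>R\<close>
  (\<open>combinations_nhd\<close>).
\<close>

section \<open>Complete topological groups\<close>

lemma nhd_add_diff:
  fixes V :: "'a::topological_ab_group_add set"
  assumes "open V" "0 \<in> V"
  obtains W where "open W" "0 \<in> W" "\<And>x y. x \<in> W \<Longrightarrow> y \<in> W \<Longrightarrow> x + y \<in> V"
    "\<And>x y. x \<in> W \<Longrightarrow> y \<in> W \<Longrightarrow> x - y \<in> V"
proof -
  have "open ((\<lambda>z::'a \<times> 'a. fst z + snd z) -` V \<inter> (\<lambda>z. fst z - snd z) -` V)" (is "open ?T")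
    using assms(1) by (intro open_Int open_vimage continuous_intros)
  moreover have "(0, 0) \<in> ?T"
    using assms(2) by simp
  ultimately obtain A B where AB: "open A" "open B" "(0,0) \<in> A \<times> B" "A \<times> B \<subseteq> ?T"
    by (rule open_prod_elim)
  show ?thesis
  proof (rule that[of "A \<inter> B"])
    show "open (A \<inter> B)" "0 \<in> A \<inter> B"
      using AB by auto
    show "x + y \<in> V" "x - y \<in> V" if "x \<in> A \<inter> B" "y \<in> A \<inter> B" for x y
      using AB(4) that by auto
  qed
qed

lemma open_translate_vimage:
  fixes G :: "'a::topological_ab_group_add set"
  assumes "open G"
  shows "open {y. y - x \<in> G}" "open {y. x - y \<in> G}"
proof -
  show "open {y. y - x \<in> G}"
    using open_vimage[OF assms, of "\<lambda>y. y - x"] by (simp add: vimage_def continuous_intros)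
  show "open {y. x - y \<in> G}"
    using open_vimage[OF assms, of "\<lambda>y. x - y"] by (simp add: vimage_def continuous_intros)
qed

lemma closure_approx:
  fixes A :: "'a::topological_ab_group_add set"
  assumes "y \<in> closure A" "open G" "0 \<in> G"
  obtains a where "a \<in> A" "y - a \<in> G"
proof -
  have "y \<in> {z. y - z \<in> G} \<inter> closure A"
    using assms by simp
  then have "{z. y - z \<in> G} \<inter> A \<noteq> {}"
    using open_Int_closure_eq_empty[OF open_translate_vimage(2)[OF assms(2)]] by blast
  then show ?thesis
    using that by blast
qed

lemma nhds_basis_seq:
  assumes "countable_nhds_basis_0 TYPE('a::topological_group_add)"
  obtains B :: "nat \<Rightarrow> 'a::topological_group_add set" where "\<And>n. open (B n)" "\<And>n. 0 \<in> B n"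
    "\<And>V. open V \<Longrightarrow> 0 \<in> V \<Longrightarrow> \<exists>n. B n \<subseteq> V"
proof -
  obtain \<B> :: "'a set set" where \<B>: "countable \<B>" "\<forall>U\<in>\<B>. open U \<and> 0 \<in> U"
    "\<forall>V. 0 \<in> interior V \<longrightarrow> (\<exists>U\<in>\<B>. U \<subseteq> V)"
    using assms unfolding countable_nhds_basis_0_def by blast
  have "\<B> \<noteq> {}"
    using \<B>(3)[rule_format, of UNIV] by auto
  then have ran: "range (from_nat_into \<B>) = \<B>"
    using \<B>(1) by (rule range_from_nat_into)
  show ?thesis
  proof (rule that[of "from_nat_into \<B>"])
    show "open (from_nat_into \<B> n)" "0 \<in> from_nat_into \<B> n" for n
      using \<B>(2) ran by blast+
    show "\<exists>n. from_nat_into \<B> n \<subseteq> V" if V: "open V" "0 \<in> V" for V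
    proof -
      have "0 \<in> interior V"
        using V by (simp add: interior_open)
      then obtain U where U: "U \<in> \<B>" "U \<subseteq> V"
        using \<B>(3) by blast
      then have "U \<in> range (from_nat_into \<B>)"
        using ran by simp
      then show ?thesis
        using U(2) by blast
    qed
  qed
qed

text \<open>
  The usual Baire construction with "diameter below \<open>1/n\<close>" replaced by "differences in the \<open>n\<close>-th
  basic neighbourhood"; this avoids metrizing the group.
\<close>

lemma baire_complete_group:
  fixes C :: "nat \<Rightarrow> 'a::topological_ab_group_add set"
  assumes basis: "countable_nhds_basis_0 TYPE('a)" and complete: "group_complete TYPE('a)"
    and closed: "\<And>n. closed (C n)" and cover: "(\<Union>n. C n) = UNIV"
  shows "\<exists>n. interior (C n) \<noteq> {}"
proof (rule ccontr)
  assume "\<not> ?thesis"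
  then have empty: "interior (C n) = {}" for n
    by blast
  obtain B :: "nat \<Rightarrow> 'a set" where B: "\<And>n. open (B n)" "\<And>n. 0 \<in> B n"
    "\<And>V. open V \<Longrightarrow> 0 \<in> V \<Longrightarrow> \<exists>n. B n \<subseteq> V"
    using nhds_basis_seq[OF basis] by blast
  let ?P = "\<lambda>n U. open U \<and> U \<noteq> {} \<and> (\<forall>x\<in>U. \<forall>y\<in>U. x - y \<in> B n)"
  \<comment> \<open>\<open>closure (x + G)\<close> lies in \<open>x + (G - G)\<close>, so bounding \<open>G - G\<close> controls the closure and
    the differences at once.\<close>
  have shrink: "\<exists>U'. ?P n U' \<and> closure U' \<subseteq> U - D"
    if U: "open U" "U \<noteq> {}" and D: "closed D" "interior D = {}" for n U D
  proof -
    have "\<not> U \<subseteq> D"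
      using U D by (metis interior_maximal subset_empty)
    then obtain x where x: "x \<in> U - D"
      by blast
    let ?V = "{g. x + g \<in> U - D} \<inter> B n"
    have "open {g. x + g \<in> U - D}"
      using open_vimage[of "U - D" "\<lambda>g. x + g"] U D
      by (simp add: vimage_def continuous_intros open_Diff)
    then have "open ?V" "0 \<in> ?V"
      using B x by auto
    then obtain G where G: "open G" "0 \<in> G" "\<And>a b. a \<in> G \<Longrightarrow> b \<in> G \<Longrightarrow> a - b \<in> ?V"
      by (rule nhd_add_diff) (rule that)
    let ?U = "{y. y - x \<in> G}"
    have "open ?U" "x \<in> ?U"
      using open_translate_vimage(1)[OF G(1)] G by auto
    moreover have "a - b \<in> B n" if "a \<in> ?U" "b \<in> ?U" for a b
      using G(3)[of "a - x" "b - x"] that by simp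
    moreover have "y \<in> U - D" if y: "y \<in> closure ?U" for y
    proof -
      have "open {g. - g \<in> G}" "0 \<in> {g. - g \<in> G}"
        using open_translate_vimage(2)[OF G(1), of 0] G(2) by simp_all
      then obtain a where "a \<in> ?U" "y - a \<in> {g. - g \<in> G}"
        by (rule closure_approx[OF y]) (rule that)
      then show ?thesis
        using G(3)[of "a - x" "a - y"] by simp
    qed
    ultimately show ?thesis
      by blast
  qed
  have "\<exists>U. \<forall>n. ?P n (U n) \<and> closure (U (Suc n)) \<subseteq> U n - C n"
  proof (rule dependent_nat_choice)
    show "\<exists>U. ?P 0 U"
      using shrink[of UNIV "{}" 0] by auto
    show "\<exists>U'. ?P (Suc n) U' \<and> closure U' \<subseteq> U - C n" if "?P n U" for U n
      using shrink[of U "C n" "Suc n"] that closed empty by blast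
  qed
  then obtain U where U: "\<And>n. ?P n (U n)" "\<And>n. closure (U (Suc n)) \<subseteq> U n - C n"
    by blast
  have dec: "U m \<subseteq> U n" if "n \<le> m" for m n
    using that
  proof (rule lift_Suc_antimono_le[rotated])
    show "U (Suc n) \<subseteq> U n" for n
      using U(2)[of n] closure_subset[of "U (Suc n)"] by blast
  qed
  have "\<exists>x. x \<in> U n" for n
    using U(1)[of n] by blast
  then obtain x where x: "\<And>n. x n \<in> U n"
    by metis
  have "group_Cauchy x"
    unfolding group_Cauchy_def
  proof (intro allI impI)
    fix V :: "'a set"
    assume "0 \<in> interior V"
    then obtain n where n: "B n \<subseteq> V"
      using B(3)[of "interior V"] interior_subset by blast
    have "x m - x k \<in> V" if "m \<ge> n" "k \<ge> n" for m k
      using U(1)[of n] x dec that n by blast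
    then show "\<exists>N0. \<forall>m\<ge>N0. \<forall>k\<ge>N0. x m - x k \<in> V"
      by blast
  qed
  then obtain l where l: "x \<longlonglongrightarrow> l"
    using complete unfolding group_complete_def by blast
  have "l \<notin> C n" for n
  proof -
    have "\<forall>\<^sub>F m in sequentially. x m \<in> closure (U (Suc n))"
      using x dec closure_subset unfolding eventually_sequentially by blast
    then have "l \<in> closure (U (Suc n))"
      using l by (intro Lim_in_closed_set[of _ x sequentially]) auto
    then show ?thesis
      using U(2) by blast
  qed
  then show False
    using cover by blast
qed

section \<open>Combinations with small coefficients\<close>

definition combinations :: "('r \<Rightarrow> 'm \<Rightarrow> 'm::comm_monoid_add) \<Rightarrow> 'm set \<Rightarrow> 'r set \<Rightarrow> 'm set"
  where "combinations smul S V = {\<Sum>s\<in>S. smul (c s) s |c. \<forall>s\<in>S. c s \<in> V}"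

lemma (in left_module) smul_zero_left [simp]: "smul 0 x = 0"
  using smul_left_distrib[of 0 0 x] by simp

lemma (in left_module) smul_zero_right [simp]: "smul a 0 = 0"
  using smul_right_distrib[of a 0 0] by simp

lemma (in left_module) smul_diff_left: "smul (a - b) x = smul a x - smul b x"
  using smul_left_distrib[of "a - b" b x] by (simp add: eq_diff_eq)

lemma (in left_module) smul_sum: "smul a (sum g S) = (\<Sum>s\<in>S. smul a (g s))"
  by (induction S rule: infinite_finite_induct) (auto simp: smul_right_distrib)

lemma (in topological_left_module) tendsto_smul:
  assumes "(g \<longlongrightarrow> a) F" "(h \<longlongrightarrow> x) F"
  shows "((\<lambda>z. smul (g z) (h z)) \<longlongrightarrow> smul a x) F"
proof (rule topological_tendstoI)
  fix G :: "'m set"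
  assume G: "open G" "smul a x \<in> G"
  have "open ((\<lambda>(a, x). smul a x) -` G)"
    by (rule open_vimage[OF G(1) continuous_smul])
  from topological_tendstoD[OF tendsto_Pair[OF assms] this] show "\<forall>\<^sub>F z in F. smul (g z) (h z) \<in> G"
    using G(2) by simp
qed

text \<open>
  The vectors \<open>g s\<close> are kept apart from the indices so that \<open>g\<close> can be a linear map: then the sums
  are the images of combinations of \<open>S\<close>.
\<close>

lemma (in topological_left_module) small_coefficients:
  assumes "finite S" "open G" "0 \<in> G"
  obtains V where "open V" "0 \<in> V"
    "\<And>c. \<forall>s\<in>S. c s \<in> V \<Longrightarrow> (\<Sum>s\<in>S. smul (c s) (g s)) \<in> G"
proof -
  have "\<exists>V. open V \<and> 0 \<in> V \<and> (\<forall>c. (\<forall>s\<in>S. c s \<in> V) \<longrightarrow> (\<Sum>s\<in>S. smul (c s) (g s)) \<in> G)"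
    using assms
  proof (induction S arbitrary: G rule: finite_induct)
    case empty
    then show ?case
      by (intro exI[of _ UNIV]) auto
  next
    case (insert t S)
    obtain H where H: "open H" "0 \<in> H" "\<And>x y. x \<in> H \<Longrightarrow> y \<in> H \<Longrightarrow> x + y \<in> G"
      by (rule nhd_add_diff[OF insert.prems]) (rule that)
    obtain V where V: "open V" "0 \<in> V"
      "\<forall>c. (\<forall>s\<in>S. c s \<in> V) \<longrightarrow> (\<Sum>s\<in>S. smul (c s) (g s)) \<in> H"
      using insert.IH[OF H(1,2)] by blast
    have "((\<lambda>a. smul a (g t)) \<longlongrightarrow> smul 0 (g t)) (nhds 0)"
      by (intro tendsto_smul tendsto_const tendsto_ident_at filterlim_ident)
    then have "\<forall>\<^sub>F a in nhds 0. smul a (g t) \<in> H"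
      using H(1,2) by (auto dest: topological_tendstoD)
    then obtain W where W: "open W" "0 \<in> W" "\<forall>a\<in>W. smul a (g t) \<in> H"
      unfolding eventually_nhds by blast
    show ?case
      using V W H insert.hyps by (intro exI[of _ "V \<inter> W"]) auto
  qed
  then show ?thesis
    using that by blast
qed

text \<open>
  The step where the units matter: \<open>u n \<cdot> _\<close> carries the \<open>n\<close>-th Baire set into \<open>closure P(W)\<close>, and
  its inverse \<open>v \<cdot> _\<close> is continuous, so an interior point there yields one of \<open>closure P(W)\<close>.
\<close>

lemma closure_combinations_nhd:
  fixes smul :: "'r::topological_ring \<Rightarrow> 'm::topological_ab_group_add \<Rightarrow> 'm"
  assumes module: "topological_left_module smul"
    and basis: "countable_nhds_basis_0 TYPE('m)" and complete: "group_complete TYPE('m)"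
    and units: "\<And>n. unit_elt (u n)" and u: "u \<longlonglongrightarrow> (0::'r)"
    and S: "finite S" "\<And>x. \<exists>c. x = (\<Sum>s\<in>S. smul (c s) s)"
    and V: "open V" "0 \<in> V"
  shows "0 \<in> interior (closure (combinations smul S V))"
proof -
  interpret topological_left_module smul by (fact module)
  obtain W where W: "open W" "0 \<in> W" "\<And>x y. x \<in> W \<Longrightarrow> y \<in> W \<Longrightarrow> x - y \<in> V"
    by (rule nhd_add_diff[OF V]) (rule that)
  have cont: "continuous_on UNIV (smul a)" for a
    unfolding continuous_on_def by (auto intro!: tendsto_smul tendsto_ident_at)
  define C where "C n = smul (u n) -` closure (combinations smul S W)" for n
  have "closed (C n)" for n
    unfolding C_def by (intro closed_vimage cont closed_closure)
  moreover have "x \<in> (\<Union>n. C n)" for x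
  proof -
    obtain c where c: "x = (\<Sum>s\<in>S. smul (c s) s)"
      using S(2) by blast
    have "\<forall>\<^sub>F n in sequentially. u n * c s \<in> W" for s
    proof -
      have "(\<lambda>n. u n * c s) \<longlonglongrightarrow> 0 * c s"
        by (intro tendsto_mult u tendsto_const)
      then show ?thesis
        using W(1,2) by (auto dest: topological_tendstoD)
    qed
    then have "\<forall>\<^sub>F n in sequentially. \<forall>s\<in>S. u n * c s \<in> W"
      using S(1) by (intro eventually_ball_finite) auto
    then obtain n where n: "\<forall>s\<in>S. u n * c s \<in> W"
      by (auto dest: eventually_happens)
    have "smul (u n) x = (\<Sum>s\<in>S. smul (u n * c s) s)"
      by (simp add: c smul_sum smul_smul)
    then have "smul (u n) x \<in> combinations smul S W"
      unfolding combinations_def using n by (auto intro!: exI[of _ "\<lambda>s. u n * c s"])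
    then show ?thesis
      using closure_subset by (auto simp: C_def)
  qed
  ultimately obtain n x where x: "x \<in> interior (C n)"
    using baire_complete_group[OF basis complete, of C] by blast
  obtain v where v: "u n * v = 1" "v * u n = 1"
    using units[of n] unfolding unit_elt_def by blast
  let ?Q = "smul v -` interior (C n)"
  have Q: "open ?Q" "smul (u n) x \<in> ?Q"
    using open_vimage[OF open_interior cont] x by (auto simp: smul_smul v smul_one)
  have Q_sub: "?Q \<subseteq> closure (combinations smul S W)"
  proof
    fix y
    assume "y \<in> ?Q"
    then have "smul v y \<in> C n"
      using interior_subset by blast
    then show "y \<in> closure (combinations smul S W)"
      by (simp add: C_def smul_smul v smul_one)
  qed
  \<comment> \<open>\<open>?T = ?Q - ?q\<close> is a neighbourhood of \<open>0\<close>; its points are differences of two points of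
    \<open>closure P(W)\<close>, and \<open>P(W) - P(W) \<subseteq> P(V)\<close>.\<close>
  let ?q = "smul (u n) x"
  let ?T = "{z. z + ?q \<in> ?Q}"
  have "open ?T"
    using open_translate_vimage(1)[OF Q(1), of "- ?q"] by simp
  moreover have "0 \<in> ?T"
    using Q(2) by simp
  moreover have "z \<in> closure (combinations smul S V)" if z: "z \<in> ?T" for z
    unfolding closure_iff_nhds_not_empty
  proof (intro allI impI)
    fix A G :: "'m set"
    assume G: "G \<subseteq> A" "open G" "z \<in> G"
    have "open {g. z - g \<in> G}" "0 \<in> {g. z - g \<in> G}"
      using open_translate_vimage(2)[OF G(2)] G(3) by auto
    then obtain H where H: "open H" "0 \<in> H" "\<And>g h. g \<in> H \<Longrightarrow> h \<in> H \<Longrightarrow> g - h \<in> {g. z - g \<in> G}"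
      by (rule nhd_add_diff) (rule that)
    obtain a where a: "a \<in> combinations smul S W" "z + ?q - a \<in> H"
      using closure_approx[OF _ H(1,2), of "z + ?q"] z Q_sub by blast
    obtain b where b: "b \<in> combinations smul S W" "?q - b \<in> H"
      using closure_approx[OF _ H(1,2), of ?q] Q(2) Q_sub by blast
    obtain c d where c: "a = (\<Sum>s\<in>S. smul (c s) s)" "\<forall>s\<in>S. c s \<in> W"
      and d: "b = (\<Sum>s\<in>S. smul (d s) s)" "\<forall>s\<in>S. d s \<in> W"
      using a(1) b(1) unfolding combinations_def by blast
    have "a - b = (\<Sum>s\<in>S. smul (c s - d s) s)"
      by (simp add: c d smul_diff_left sum_subtractf)
    then have "a - b \<in> combinations smul S V"
      unfolding combinations_def using c(2) d(2) W(3)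
      by (auto intro!: exI[of _ "\<lambda>s. c s - d s"])
    moreover have "a - b \<in> G"
      using H(3)[OF a(2) b(2)] by (simp add: algebra_simps)
    ultimately show "combinations smul S V \<inter> A \<noteq> {}"
      using G(1) by blast
  qed
  ultimately show ?thesis
    by (meson interiorI subsetI)
qed

section \<open>Openness of the parametrization\<close>

text \<open>
  The substitute for bounding the tail of a series by a geometric series with ratio
  \<open>1/2\<close>, uniformly in the number \<open>n\<close> of terms; it makes the partial sums below Cauchy.
\<close>

lemma sum_halving_nhds:
  fixes c :: "nat \<Rightarrow> 'a::comm_monoid_add"
  assumes "\<And>k. 0 \<in> V k" "\<And>k x y. x \<in> V (Suc k) \<Longrightarrow> y \<in> V (Suc k) \<Longrightarrow> x + y \<in> V k"
    and "\<And>k. c k \<in> V (Suc k)"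
  shows "(\<Sum>j<n. c (k + j)) \<in> V k"
proof (induction n arbitrary: k)
  case 0
  then show ?case
    using assms(1) by simp
next
  case (Suc n)
  have "(\<Sum>j<Suc n. c (k + j)) = c k + (\<Sum>j<n. c (Suc k + j))"
    by (simp add: sum.lessThan_Suc_shift del: sum.lessThan_Suc)
  then show ?case
    using assms(2)[OF assms(3) Suc.IH] by simp
qed

text \<open>
  Successive approximation as in the open mapping theorem, run on coefficients: the limit is taken
  in \<open>R\<close>, one coefficient at a time, and the Hausdorff property of \<open>M\<close> identifies
  the given point with the combination of the limits.
\<close>

lemma combinations_nhd:
  fixes smul :: "'r::topological_ring \<Rightarrow> 'm::{topological_ab_group_add,t2_space} \<Rightarrow> 'm"
  assumes module: "topological_left_module smul"
    and basis_ring: "countable_nhds_basis_0 TYPE('r)" and complete_ring: "group_complete TYPE('r)"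
    and S: "finite S"
    and almost: "\<And>V. open V \<Longrightarrow> 0 \<in> V \<Longrightarrow> 0 \<in> interior (closure (combinations smul S V))"
    and U: "open U" "0 \<in> U"
  shows "0 \<in> interior (combinations smul S U)"
proof -
  interpret topological_left_module smul by (fact module)
  let ?lc = "\<lambda>c. \<Sum>s\<in>S. smul (c s) s"
  obtain B :: "nat \<Rightarrow> 'r set" where B: "\<And>n. open (B n)" "\<And>n. 0 \<in> B n"
    "\<And>V. open V \<Longrightarrow> 0 \<in> V \<Longrightarrow> \<exists>n. B n \<subseteq> V"
    using nhds_basis_seq[OF basis_ring] by blast
  obtain U0 where U0: "open U0" "0 \<in> U0" "\<And>x y. x \<in> U0 \<Longrightarrow> y \<in> U0 \<Longrightarrow> x + y \<in> U"
    by (rule nhd_add_diff[OF U]) (rule that)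
  have "\<exists>V. \<forall>k. (open (V k) \<and> 0 \<in> V k \<and> V k \<subseteq> U0 \<inter> B k) \<and>
      (\<forall>x\<in>V (Suc k). \<forall>y\<in>V (Suc k). x + y \<in> V k \<and> x - y \<in> V k)"
  proof (rule dependent_nat_choice)
    show "\<exists>V. open V \<and> 0 \<in> V \<and> V \<subseteq> U0 \<inter> B 0"
      using B U0 by (intro exI[of _ "U0 \<inter> B 0"]) auto
    show "\<exists>V'. (open V' \<and> 0 \<in> V' \<and> V' \<subseteq> U0 \<inter> B (Suc k)) \<and>
        (\<forall>x\<in>V'. \<forall>y\<in>V'. x + y \<in> V \<and> x - y \<in> V)"
      if V: "open V \<and> 0 \<in> V \<and> V \<subseteq> U0 \<inter> B k" for V k
    proof -
      have "open V" "0 \<in> V"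
        using V by auto
      then obtain W where "open W" "0 \<in> W" "\<And>x y. x \<in> W \<Longrightarrow> y \<in> W \<Longrightarrow> x + y \<in> V"
        "\<And>x y. x \<in> W \<Longrightarrow> y \<in> W \<Longrightarrow> x - y \<in> V"
        by (rule nhd_add_diff) (rule that)
      then show ?thesis
        using B U0 by (intro exI[of _ "W \<inter> U0 \<inter> B (Suc k)"]) auto
    qed
  qed
  then obtain V where V: "\<And>k. open (V k)" "\<And>k. 0 \<in> V k" "\<And>k. V k \<subseteq> U0" "\<And>k. V k \<subseteq> B k"
    "\<And>k x y. x \<in> V (Suc k) \<Longrightarrow> y \<in> V (Suc k) \<Longrightarrow> x + y \<in> V k"
    "\<And>k x y. x \<in> V (Suc k) \<Longrightarrow> y \<in> V (Suc k) \<Longrightarrow> x - y \<in> V k"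
    by (metis le_inf_iff)
  have dec: "V m \<subseteq> V n" if "n \<le> m" for m n
    using that
  proof (rule lift_Suc_antimono_le[rotated])
    show "V (Suc n) \<subseteq> V n" for n
      using V(5)[of _ n 0] V(2) by auto
  qed
  have "closure (combinations smul S (V 1)) \<subseteq> combinations smul S U"
  proof
    fix y
    assume y: "y \<in> closure (combinations smul S (V 1))"
    \<comment> \<open>\<open>z k\<close> is what remains of \<open>y\<close> after \<open>k\<close> approximations. As \<open>closure P(V (k + 2))\<close> is a
      neighbourhood of \<open>0\<close>, some element of \<open>P(V (k + 1))\<close> approximates \<open>z k\<close> with an error
      in it.\<close>
    have "\<exists>z. \<forall>k. (z k \<in> closure (combinations smul S (V (Suc k))) \<and> (k = 0 \<longrightarrow> z k = y)) \<and>
      (\<exists>c. (\<forall>s\<in>S. c s \<in> V (Suc k)) \<and> z (Suc k) = z k - ?lc c)"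
    proof (rule dependent_nat_choice)
      show "\<exists>z. z \<in> closure (combinations smul S (V (Suc 0))) \<and> (0 = (0::nat) \<longrightarrow> z = y)"
        using y by auto
      show "\<exists>z'. (z' \<in> closure (combinations smul S (V (Suc (Suc k)))) \<and> (Suc k = 0 \<longrightarrow> z' = y)) \<and>
          (\<exists>c. (\<forall>s\<in>S. c s \<in> V (Suc k)) \<and> z' = z - ?lc c)"
        if z: "z \<in> closure (combinations smul S (V (Suc k))) \<and> (k = 0 \<longrightarrow> z = y)" for z k
      proof -
        have "z \<in> closure (combinations smul S (V (Suc k)))"
          using z by blast
        then obtain a where a: "a \<in> combinations smul S (V (Suc k))"
          "z - a \<in> interior (closure (combinations smul S (V (Suc (Suc k)))))"
          by (rule closure_approx[OF _ open_interior almost[OF V(1,2)]]) (rule that)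
        then obtain c where "\<forall>s\<in>S. c s \<in> V (Suc k)" "a = ?lc c"
          unfolding combinations_def by blast
        then show ?thesis
          using a(2) interior_subset by blast
      qed
    qed
    then obtain z where z: "\<And>k. z k \<in> closure (combinations smul S (V (Suc k)))" "z 0 = y"
      "\<forall>k. \<exists>c. (\<forall>s\<in>S. c s \<in> V (Suc k)) \<and> z (Suc k) = z k - ?lc c"
      by metis
    then obtain c where c: "\<And>k s. s \<in> S \<Longrightarrow> c k s \<in> V (Suc k)" "\<And>k. z (Suc k) = z k - ?lc (c k)"
      by metis
    define p where "p s n = (\<Sum>j<n. c j s)" for s n
    have z_eq: "z n = y - ?lc (\<lambda>s. p s n)" for n
      by (induction n) (simp_all add: p_def z(2) c(2) smul_left_distrib sum.distrib)
    have tail: "p s m - p s k \<in> V k" if "s \<in> S" "k \<le> m" for s k m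
    proof -
      have "(\<Sum>j<k + i. c j s) = (\<Sum>j<k. c j s) + (\<Sum>j<i. c (k + j) s)" for i
        by (induction i) (simp_all add: add.assoc)
      from this[of "m - k"] have "p s m - p s k = (\<Sum>j<m - k. c (k + j) s)"
        using that(2) by (simp add: p_def)
      also have "\<dots> \<in> V k"
        using V(2,5) c(1)[OF that(1)] by (rule sum_halving_nhds)
      finally show ?thesis .
    qed
    have "\<exists>l. p s \<longlonglongrightarrow> l" if s: "s \<in> S" for s
    proof -
      have "group_Cauchy (p s)"
        unfolding group_Cauchy_def
      proof (intro allI impI)
        fix A :: "'r set"
        assume "0 \<in> interior A"
        then obtain n where "B n \<subseteq> A"
          using B(3)[of "interior A"] interior_subset by blast
        then have n: "V n \<subseteq> A"
          using V(4) by blast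
        have "p s m - p s k \<in> A" if "m \<ge> Suc n" "k \<ge> Suc n" for m k
        proof -
          have "(p s m - p s (Suc n)) - (p s k - p s (Suc n)) \<in> V n"
            by (rule V(6)[OF tail[OF s that(1)] tail[OF s that(2)]])
          then show ?thesis
            using n by auto
        qed
        then show "\<exists>N0. \<forall>m\<ge>N0. \<forall>k\<ge>N0. p s m - p s k \<in> A"
          by blast
      qed
      then show ?thesis
        using complete_ring unfolding group_complete_def by blast
    qed
    then obtain l where l: "\<And>s. s \<in> S \<Longrightarrow> p s \<longlonglongrightarrow> l s"
      by metis
    have l_U: "l s \<in> U" if s: "s \<in> S" for s
    proof -
      have "p s n \<in> V 0" for n
        using tail[OF s, of 0 n] by (simp add: p_def)
      then have "\<forall>\<^sub>F n in sequentially. p s n \<in> closure (V 0)"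
        using closure_subset by (auto intro!: always_eventually)
      then have "l s \<in> closure (V 0)"
        using l[OF s] by (intro Lim_in_closed_set[of _ "p s" sequentially]) auto
      then obtain a where "a \<in> V 0" "l s - a \<in> U0"
        by (rule closure_approx[OF _ U0(1,2)]) (rule that)
      then show ?thesis
        using U0(3)[of "l s - a" a] V(3) by auto
    qed
    \<comment> \<open>Membership of \<open>z m\<close> in the closure of \<open>P(V (Suc m))\<close> costs one summand \<open>z m - a\<close>;
      hence \<open>H + H \<subseteq> G\<close>.\<close>
    have "z \<longlonglongrightarrow> 0"
    proof (rule topological_tendstoI)
      fix G :: "'m set"
      assume "open G" "0 \<in> G"
      then obtain H where H: "open H" "0 \<in> H" "\<And>x y. x \<in> H \<Longrightarrow> y \<in> H \<Longrightarrow> x + y \<in> G"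
        by (rule nhd_add_diff) (rule that)
      obtain A where A: "open A" "0 \<in> A" "\<And>d. \<forall>s\<in>S. d s \<in> A \<Longrightarrow> ?lc d \<in> H"
        by (rule small_coefficients[OF S H(1,2), of "\<lambda>s. s"]) (rule that)
      obtain n where "B n \<subseteq> A"
        using B(3)[OF A(1,2)] by blast
      then have n: "V n \<subseteq> A"
        using V(4) by blast
      have "z m \<in> G" if m: "m \<ge> n" for m
      proof -
        obtain a where a: "a \<in> combinations smul S (V (Suc m))" "z m - a \<in> H"
          by (rule closure_approx[OF z(1) H(1,2)]) (rule that)
        obtain d where d: "a = ?lc d" "\<forall>s\<in>S. d s \<in> V (Suc m)"
          using a(1) unfolding combinations_def by blast
        have "V (Suc m) \<subseteq> A"
          using dec[of n "Suc m"] m n by auto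
        then have "a \<in> H"
          unfolding d(1) using d(2) by (intro A(3)) auto
        then show ?thesis
          using H(3)[OF a(2), of a] by simp
      qed
      then show "\<forall>\<^sub>F m in sequentially. z m \<in> G"
        unfolding eventually_sequentially by blast
    qed
    moreover have "(\<lambda>n. y - ?lc (\<lambda>s. p s n)) \<longlonglongrightarrow> y - ?lc l"
      by (intro tendsto_diff tendsto_const tendsto_sum tendsto_smul l)
    then have "z \<longlonglongrightarrow> y - ?lc l"
      unfolding z_eq[symmetric] .
    ultimately have "0 = y - ?lc l"
      by (rule LIMSEQ_unique)
    then have "y = ?lc l"
      by simp
    then show "y \<in> combinations smul S U"
      unfolding combinations_def using l_U by blast
  qed
  from interior_mono[OF this] show ?thesis
    using almost[OF V(1,2), of 1] by blast
qed

section \<open>Automatic continuity\<close>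

lemma additive_continuous_if_continuous_at_0:
  fixes f :: "'a::topological_ab_group_add \<Rightarrow> 'b::topological_ab_group_add"
  assumes add: "\<And>x y. f (x + y) = f x + f y"
    and at_0: "\<And>G. open G \<Longrightarrow> 0 \<in> G \<Longrightarrow> \<exists>A. open A \<and> 0 \<in> A \<and> f ` A \<subseteq> G"
  shows "continuous_on UNIV f"
  unfolding continuous_on_topological
proof (intro ballI allI impI)
  fix x B
  assume B: "open B" "f x \<in> B"
  have "open {g. g + f x \<in> B}" "0 \<in> {g. g + f x \<in> B}"
    using open_translate_vimage(1)[OF B(1), of "- f x"] B(2) by auto
  then obtain A where A: "open A" "0 \<in> A" "f ` A \<subseteq> {g. g + f x \<in> B}"
    using at_0 by blast
  have "f y \<in> B" if "y - x \<in> A" for y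
    using A(3) add[of "y - x" x] that by auto
  then show "\<exists>A. open A \<and> x \<in> A \<and> (\<forall>y\<in>UNIV. y \<in> A \<longrightarrow> f y \<in> B)"
    using open_translate_vimage(1)[OF A(1), of x] A(2)
    by (intro exI[of _ "{y. y - x \<in> A}"]) auto
qed

lemma (in left_module_hom) map_sum_smul: "f (\<Sum>s\<in>S. smulM (c s) (g s)) =
    (\<Sum>s\<in>S. smulN (c s) (f (g s)))"
proof -
  have "f 0 = 0"
    using map_add[of 0 0] by simp
  then show ?thesis
    by (induction S rule: infinite_finite_induct) (simp_all add: map_add map_smul)
qed

theorem theorem0p2:
  fixes smulM :: "'r::{topological_ring,t2_space} \<Rightarrow> 'm::{topological_ab_group_add,t2_space} \<Rightarrow> 'm"
    and smulN :: "'r \<Rightarrow> 'n::topological_ab_group_add \<Rightarrow> 'n"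
    and f :: "'m \<Rightarrow> 'n"
  assumes "countable_nhds_basis_0 TYPE('r)"
    and "group_complete TYPE('r)"
    and "\<exists>u :: nat \<Rightarrow> 'r. (\<forall>n. unit_elt (u n)) \<and> u \<longlonglongrightarrow> 0"
    and "topological_left_module smulM"
    and "countable_nhds_basis_0 TYPE('m)"
    and "group_complete TYPE('m)"
    and "finitely_generated smulM"
    and "topological_left_module smulN"
    and "left_module_hom smulM smulN f"
  shows "continuous_on UNIV f"
proof -
  interpret left_module_hom smulM smulN f by fact
  interpret N: topological_left_module smulN by fact
  obtain u :: "nat \<Rightarrow> 'r" where u: "\<And>n. unit_elt (u n)" "u \<longlonglongrightarrow> 0"
    using assms(3) by blast
  obtain S where S: "finite S" "\<And>x. \<exists>c. x = (\<Sum>s\<in>S. smulM (c s) s)"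
    using assms(7) unfolding finitely_generated_def by blast
  have nhd: "0 \<in> interior (combinations smulM S V)" if "open V" "0 \<in> V" for V
    using assms(1,2,4) S(1) closure_combinations_nhd[OF assms(4-6) u S] that
    by (intro combinations_nhd)
  show ?thesis
  proof (rule additive_continuous_if_continuous_at_0)
    show "\<exists>A. open A \<and> 0 \<in> A \<and> f ` A \<subseteq> G" if G: "open G" "0 \<in> G" for G
    proof -
      obtain V where V: "open V" "0 \<in> V"
        "\<And>c. \<forall>s\<in>S. c s \<in> V \<Longrightarrow> (\<Sum>s\<in>S. smulN (c s) (f s)) \<in> G"
        by (rule N.small_coefficients[OF S(1) G, of f]) (rule that)
      have "f ` combinations smulM S V \<subseteq> G"
        using V(3) by (auto simp: combinations_def map_sum_smul)
      then show ?thesis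
        using nhd[OF V(1,2)] interior_subset
        by (intro exI[of _ "interior (combinations smulM S V)"]) blast
    qed
  qed (rule map_add)
qed

end
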